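(* Let $\Theta_1,\Theta_2$ be Young functions such that $\Theta_1\prec\Theta_2$ and $\Theta_1^{-1}\lesssim\Theta_2^{-1}$, and let $\theta_1\in G_{\theta_1}$ (with respect to $\Theta_1$) and $\theta_2\in G_{\theta_2}$ (with respect to $\Theta_2$). Then the following statements are equivalent: (1) $\theta_2\lesssim\theta_1$. (2) $w\mathcal{M}_{\theta_2,\Theta_2}(\mathbb{R}^n)\subseteq w\mathcal{M}_{\theta_1,\Theta_1}(\mathbb{R}^n)$. (3) There exists a constant $C>0$ such that $\|f\|_{w\mathcal{M}_{\theta_1,\Theta_1}(\mathbb{R}^n)}\le C\,\|f\|_{w\mathcal{M}_{\theta_2,\Theta_2}(\mathbb{R}^n)}$ for every $f\in w\mathcal{M}_{\theta_2,\Theta_2}(\mathbb{R}^n)$.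
   Context: A Young function is a function $\Theta:[0,\infty)\to[0,\infty)$ that is convex and continuous with $\lim_{t\to0}\Theta(t)=0=\Theta(0)$ and $\lim_{t\to\infty}\Theta(t)=\infty$. Its generalized inverse is $\Theta^{-1}(s):=\inf\{r\ge0:\Theta(r)>s\}$. For Young functions, $\Theta_1\prec\Theta_2$ means that there exists a constant $C>0$ with $\Theta_1(t)\le\Theta_2(Ct)$ for all $t>0$. For nonnegative functions $g_1,g_2$ on $(0,\infty)$, $g_1\lesssim g_2$ means that there exists a constant $C>0$ with $g_1(t)\le C g_2(t)$ for all $t>0$ (this is used both for $\theta_1,\theta_2$ and for $\Theta_1^{-1},\Theta_2^{-1}$). Given a Young function $\Theta$, the class $G_\theta$ (with respect to $\Theta$) is the set of all functions $\theta:(0,\infty)\to(0,\infty)$ such that $\theta$ is decreasing and $t\mapsto\Theta^{-1}(t^{-n})\,\theta(t)^{-1}$ is almost decreasing on $(0,\infty)$; a function $g$ is almost decreasing if there is a constant $C>0$ with $g(t)\le C g(s)$ whenever $0<s\le t$. $B(a,r)$ denotes the open ball in $\mathbb{R}^n$ with center $a$ and radius $r>0$, and $|E|$ denotes the Lebesgue measure of $E$. For a Young function $\Theta$ and $\theta\in G_\theta$ (with respect to $\Theta$), the weak Orlicz--Morrey space $w\mathcal{M}_{\theta,\Theta}(\mathbb{R}^n)$ (of the third version) is the set of all measurable functions $f$ on $\mathbb{R}^n$ such that $$\|f\|_{w\mathcal{M}_{\theta,\Theta}(\mathbb{R}^n)}:=\sup_{a\in\mathbb{R}^n,\ r>0}\frac{1}{\theta(|B(a,r)|^{1/n})}\,\Theta^{-1}\Bigl(\frac{1}{|B(a,r)|}\Bigr)\,\|f\|_{wL_\Theta(B(a,r))}<\infty,$$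 where $$\|f\|_{wL_\Theta(B(a,r))}:=\inf\Bigl\{b>0:\ \sup_{t>0}\Theta(t)\,\Bigl|\Bigl\{x\in B(a,r):\frac{|f(x)|}{b}>t\Bigr\}\Bigr|\le1\Bigr\}.$$ *)

theory Defs
  imports "HOL-Analysis.Analysis"
begin

text \<open>
  Functions on \<open>[0,\<infinity>)\<close> or \<open>(0,\<infinity>)\<close> are represented by functions of type
  \<^typ>\<open>real \<Rightarrow> real\<close>; their values outside the respective domain are never used.
\<close>

definition young_function :: "(real \<Rightarrow> real) \<Rightarrow> bool" where
  "young_function \<Theta> \<longleftrightarrow>
     (\<forall>t\<ge>0. \<Theta> t \<ge> 0) \<and> convex_on {0..} \<Theta> \<and> continuous_on {0..} \<Theta> \<and>
     (\<Theta> \<longlongrightarrow> 0) (at_right 0) \<and> \<Theta> 0 = 0 \<and> filterlim \<Theta> at_top at_top"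

definition gen_inverse :: "(real \<Rightarrow> real) \<Rightarrow> real \<Rightarrow> real" where
  "gen_inverse \<Theta> s = Inf {r. r \<ge> 0 \<and> \<Theta> r > s}"

definition young_prec :: "(real \<Rightarrow> real) \<Rightarrow> (real \<Rightarrow> real) \<Rightarrow> bool"  (infix "\<prec>\<^sub>Y" 50) where
  "\<Theta>1 \<prec>\<^sub>Y \<Theta>2 \<longleftrightarrow> (\<exists>C>0. \<forall>t>0. \<Theta>1 t \<le> \<Theta>2 (C * t))"

definition less_sim :: "(real \<Rightarrow> real) \<Rightarrow> (real \<Rightarrow> real) \<Rightarrow> bool"  (infix "\<lesssim>" 50) where
  "g1 \<lesssim> g2 \<longleftrightarrow> (\<exists>C>0. \<forall>t>0. g1 t \<le> C * g2 t)"

definition almost_decreasing :: "(real \<Rightarrow> real) \<Rightarrow> bool" where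
  "almost_decreasing g \<longleftrightarrow> (\<exists>C>0. \<forall>s t. 0 < s \<and> s \<le> t \<longrightarrow> g t \<le> C * g s)"

definition G_class :: "nat \<Rightarrow> (real \<Rightarrow> real) \<Rightarrow> (real \<Rightarrow> real) set" where
  "G_class n \<Theta> = {\<theta>. (\<forall>t>0. \<theta> t > 0) \<and> antimono_on {0<..} \<theta> \<and>
     almost_decreasing (\<lambda>t. gen_inverse \<Theta> (1 / t ^ n) * inverse (\<theta> t))}"

text \<open>
  Both quasi-norms take values in \<open>[0,\<infinity>]\<close>. In \<^typ>\<open>ennreal\<close> the infimum of the empty set
  is \<open>\<infinity>\<close>, so functions for which no admissible \<open>b\<close> exists have infinite quasi-norm.
\<close>

definition wL_norm ::
    "(real \<Rightarrow> real) \<Rightarrow> (real ^ 'n) set \<Rightarrow> (real ^ 'n \<Rightarrow> 'b::real_normed_vector) \<Rightarrow> ennreal" where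
  "wL_norm \<Theta> E f =
     Inf (ennreal ` {b. b > 0 \<and>
       (SUP t\<in>{0<..}. ennreal (\<Theta> t) * emeasure lebesgue {x \<in> E. norm (f x) / b > t}) \<le> 1})"

definition wOM_norm ::
    "(real \<Rightarrow> real) \<Rightarrow> (real \<Rightarrow> real) \<Rightarrow> (real ^ 'n \<Rightarrow> 'b::real_normed_vector) \<Rightarrow> ennreal" where
  "wOM_norm \<theta> \<Theta> f =
     (SUP (a, r) \<in> UNIV \<times> {0<..}.
        ennreal (1 / \<theta> (measure lebesgue (ball a r) powr (1 / real CARD('n)))
                 * gen_inverse \<Theta> (1 / measure lebesgue (ball a r)))
        * wL_norm \<Theta> (ball a r) f)"

definition wOM_space ::
    "(real \<Rightarrow> real) \<Rightarrow> (real \<Rightarrow> real) \<Rightarrow> (real ^ 'n \<Rightarrow> 'b::real_normed_vector) set" where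
  "wOM_space \<theta> \<Theta> = {f. f \<in> borel_measurable lebesgue \<and> wOM_norm \<theta> \<Theta> f < \<infinity>}"

end

theory Submission imports Defs begin

text \<open>
  (1) implies (3) by comparing the three factors of the quasi-norms. If (1) fails, pick balls
  \<open>B\<^sub>k\<close> of size \<open>t\<^sub>k\<close> about the origin on which \<open>\<theta>2 t\<^sub>k / \<theta>1 t\<^sub>k\<close> exceeds \<open>(k + 1) 2 ^ (k + 1)\<close>; the
  supremum over \<open>k\<close> of \<open>2 ^ -(k + 1) \<theta>2 t\<^sub>k\<close> times the characteristic function of \<open>B\<^sub>k\<close> lies in
  the second space but not in the first, so (2) fails. This avoids a closed graph theorem for
  quasi-Banach spaces.
\<close>

section \<open>Young functions and their generalized inverses\<close>

lemma young_function_nonneg: "young_function \<Theta> \<Longrightarrow> 0 \<le> t \<Longrightarrow> 0 \<le> \<Theta> t"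
  by (simp add: young_function_def)

text \<open>Convexity between 0 and \<open>t\<close>, with \<Theta> vanishing at 0. Later it turns
  the weight of a ball into the same gain in a measure estimate.\<close>

lemma young_function_scale_le:
  assumes "young_function \<Theta>" "0 \<le> t" "0 \<le> c" "c \<le> 1"
  shows "\<Theta> (c * t) \<le> c * \<Theta> t"
proof -
  have "convex_on {0..} \<Theta>" "\<Theta> 0 = 0"
    using assms(1) by (auto simp: young_function_def)
  with convex_onD[of "{0..}" \<Theta> c 0 t] assms show ?thesis by simp
qed

text \<open>A real infimum is informative only over a nonempty set; the divergence of \<Theta> at
  infinity supplies an element for every level \<open>s\<close>.\<close>

lemma gen_inverse_superlevel_nonempty:
  assumes "young_function \<Theta>"
  shows "{r. r \<ge> 0 \<and> \<Theta> r > s} \<noteq> {}"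
proof -
  have "filterlim \<Theta> at_top at_top"
    using assms by (simp add: young_function_def)
  then have "eventually (\<lambda>r. \<Theta> r > s) at_top"
    by (simp add: filterlim_at_top_dense)
  then have "eventually (\<lambda>r. \<Theta> r > s \<and> r \<ge> 0) at_top"
    using eventually_ge_at_top[of "0::real"] by eventually_elim simp
  then obtain r where "\<Theta> r > s \<and> r \<ge> 0"
    using eventually_happens trivial_limit_at_top_linorder by blast
  then show ?thesis by blast
qed

lemma le_of_less_gen_inverse:
  assumes "0 \<le> t" "t < gen_inverse \<Theta> s"
  shows "\<Theta> t \<le> s"
proof (rule ccontr)
  assume "\<not> \<Theta> t \<le> s"
  then have "gen_inverse \<Theta> s \<le> t"
    unfolding gen_inverse_def using assms(1) by (intro cInf_lower bdd_belowI[of _ 0]) auto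
  with assms(2) show False by simp
qed

lemma gen_inverse_greatest:
  assumes "young_function \<Theta>" "\<And>r. 0 \<le> r \<Longrightarrow> s < \<Theta> r \<Longrightarrow> c \<le> r"
  shows "c \<le> gen_inverse \<Theta> s"
  unfolding gen_inverse_def using gen_inverse_superlevel_nonempty[OF assms(1)] assms(2)
  by (intro cInf_greatest) auto

lemma gen_inverse_mono:
  assumes "young_function \<Theta>" "s \<le> s'"
  shows "gen_inverse \<Theta> s \<le> gen_inverse \<Theta> s'"
  unfolding gen_inverse_def using gen_inverse_superlevel_nonempty[OF assms(1)] assms(2)
  by (intro cInf_superset_mono bdd_belowI[of _ 0]) auto

text \<open>Since \<Theta> tends to 0 at 0, it stays below \<open>s\<close> on some interval from 0
  to \<open>d\<close>, and the infimum cannot fall below \<open>d\<close>. Positivity is what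
  permits dividing by the inverse later.\<close>

lemma gen_inverse_pos:
  assumes "young_function \<Theta>" "0 < s"
  shows "0 < gen_inverse \<Theta> s"
proof -
  have "(\<Theta> \<longlongrightarrow> 0) (at_right 0)" "\<Theta> 0 = 0"
    using assms(1) by (auto simp: young_function_def)
  then have "eventually (\<lambda>r. \<Theta> r < s) (at_right 0)"
    using assms(2) order_tendstoD(2) by blast
  then obtain d where d: "d > 0" "\<And>r. 0 < r \<Longrightarrow> r < d \<Longrightarrow> \<Theta> r < s"
    by (auto simp: eventually_at_right_field)
  have "d \<le> gen_inverse \<Theta> s"
  proof (rule gen_inverse_greatest[OF assms(1)])
    fix r assume "0 \<le> r" "s < \<Theta> r"
    with d(2)[of r] \<open>\<Theta> 0 = 0\<close> assms(2) show "d \<le> r"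
      by (cases "r = 0"; cases "r < d") auto
  qed
  with d(1) show ?thesis by simp
qed

section \<open>The weak Orlicz quasi-norm on a set\<close>

lemma le_ennreal_mult_of_divide_le:
  assumes "0 < c" "x / ennreal c \<le> y"
  shows "x \<le> ennreal c * y"
proof -
  have "x = x / ennreal c * ennreal c"
    using assms(1) by (simp add: ennreal_divide_times)
  also have "\<dots> \<le> y * ennreal c"
    using assms(2) by (rule mult_right_mono) simp
  finally show ?thesis by (simp add: mult.commute)
qed

definition wL_admissible ::
    "(real \<Rightarrow> real) \<Rightarrow> (real ^ 'n) set \<Rightarrow> (real ^ 'n \<Rightarrow> 'b::real_normed_vector) \<Rightarrow> real \<Rightarrow> bool" where
  "wL_admissible \<Theta> E f b \<longleftrightarrow> b > 0 \<and>
     (\<forall>t>0. ennreal (\<Theta> t) * emeasure lebesgue {x \<in> E. norm (f x) / b > t} \<le> 1)"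

lemma wL_norm_eq: "wL_norm \<Theta> E f = Inf (ennreal ` {b. wL_admissible \<Theta> E f b})"
  unfolding wL_norm_def wL_admissible_def
  by (intro arg_cong[where f = Inf] arg_cong[where f = "\<lambda>A. ennreal ` A"])
     (auto simp: SUP_le_iff)

lemma wL_norm_le: "wL_admissible \<Theta> E f b \<Longrightarrow> wL_norm \<Theta> E f \<le> ennreal b"
  unfolding wL_norm_eq by (rule Inf_lower) auto

lemma le_wL_norm:
  assumes "\<And>b. wL_admissible \<Theta> E f b \<Longrightarrow> z \<le> ennreal b"
  shows "z \<le> wL_norm \<Theta> E f"
  unfolding wL_norm_eq using assms by (intro Inf_greatest) auto

text \<open>Dividing by \<open>C * b\<close> instead of \<open>b\<close> moves the threshold from
  \<open>t\<close> to \<open>C * t\<close>, which is exactly the argument at which \<Theta>2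
  dominates \<Theta>1.\<close>

lemma wL_admissible_scale:
  assumes "C > 0" "\<And>t. t > 0 \<Longrightarrow> \<Theta>1 t \<le> \<Theta>2 (C * t)" "wL_admissible \<Theta>2 E f b"
  shows "wL_admissible \<Theta>1 E f (C * b)"
  unfolding wL_admissible_def
proof (intro conjI allI impI)
  have b: "b > 0" using assms(3) by (simp add: wL_admissible_def)
  then show "C * b > 0" using assms(1) by simp
  fix t :: real assume t: "t > 0"
  have "{x \<in> E. norm (f x) / (C * b) > t} = {x \<in> E. norm (f x) / b > C * t}"
    using assms(1) b by (auto simp: field_simps)
  then have "ennreal (\<Theta>1 t) * emeasure lebesgue {x \<in> E. norm (f x) / (C * b) > t}
      \<le> ennreal (\<Theta>2 (C * t)) * emeasure lebesgue {x \<in> E. norm (f x) / b > C * t}"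
    using assms(2)[OF t] by (auto intro!: mult_right_mono ennreal_leI)
  also have "\<dots> \<le> 1"
    using assms(1,3) t by (simp add: wL_admissible_def)
  finally show "ennreal (\<Theta>1 t) * emeasure lebesgue {x \<in> E. norm (f x) / (C * b) > t} \<le> 1" .
qed

text \<open>Moving \<open>C\<close> to the left reduces the claim to a lower bound for an infimum,
  which can be checked on each admissible \<open>b\<close> and holds vacuously if there is
  none.\<close>

lemma wL_norm_young_prec:
  assumes "C > 0" "\<And>t. t > 0 \<Longrightarrow> \<Theta>1 t \<le> \<Theta>2 (C * t)"
  shows "wL_norm \<Theta>1 E f \<le> ennreal C * wL_norm \<Theta>2 E f"
proof -
  have "wL_norm \<Theta>1 E f / ennreal C \<le> wL_norm \<Theta>2 E f"
  proof (rule le_wL_norm)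
    fix b assume b: "wL_admissible \<Theta>2 E f b"
    from wL_norm_le[OF wL_admissible_scale[OF assms b]]
    have "wL_norm \<Theta>1 E f \<le> ennreal C * ennreal b"
      using assms(1) b by (simp add: ennreal_mult wL_admissible_def)
    then show "wL_norm \<Theta>1 E f / ennreal C \<le> ennreal b"
      using assms(1) by (intro divide_le_posI_ennreal) auto
  qed
  then show ?thesis
    using assms(1) by (rule le_ennreal_mult_of_divide_le[rotated])
qed

text \<open>The lower half of the formula \<open>1 / gen_inverse \<Theta> (1 / |A|)\<close> for the
  quasi-norm of a characteristic function. For admissible \<open>b\<close> and
  \<open>r < c / b\<close>, all of \<open>A\<close> lies above level \<open>r\<close>, so
  \<open>\<Theta> r * |A| \<le> 1\<close>; hence \<open>c / b\<close> is at most the inverse at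
  \<open>1 / |A|\<close>.\<close>

lemma le_gen_inverse_mult_wL_norm:
  fixes f :: "real ^ 'n \<Rightarrow> 'b::euclidean_space"
  assumes "young_function \<Theta>" "f \<in> borel_measurable lebesgue" "E \<in> sets lebesgue"
    and A: "A \<in> lmeasurable" "A \<subseteq> E" "measure lebesgue A > 0"
    and c: "\<And>x. x \<in> A \<Longrightarrow> c \<le> norm (f x)"
  shows "ennreal c \<le> ennreal (gen_inverse \<Theta> (1 / measure lebesgue A)) * wL_norm \<Theta> E f"
proof -
  define m where "m = measure lebesgue A"
  define g where "g = gen_inverse \<Theta> (1 / m)"
  have m: "m > 0" using A by (simp add: m_def)
  have g: "g > 0" unfolding g_def using m by (intro gen_inverse_pos assms) simp
  have "ennreal c / ennreal g \<le> wL_norm \<Theta> E f"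
  proof (rule le_wL_norm)
    fix b assume b: "wL_admissible \<Theta> E f b"
    then have b0: "b > 0" by (simp add: wL_admissible_def)
    have "c / b \<le> g"
      unfolding g_def
    proof (rule gen_inverse_greatest[OF assms(1)], rule ccontr)
      fix r assume r: "0 \<le> r" "1 / m < \<Theta> r" and "\<not> c / b \<le> r"
      then have rc: "r < c / b" by simp
      \<comment> \<open>Admissibility tests positive levels only, so \<open>r = 0\<close> is
        excluded first.\<close>
      have "\<Theta> 0 = 0" "0 < 1 / m"
        using m assms(1) by (auto simp: young_function_def)
      with r have r0: "r > 0" by (cases "r = 0") auto
      have [measurable]: "f \<in> borel_measurable lebesgue" "E \<in> sets lebesgue"
        by (fact assms)+
      have sub: "A \<subseteq> {x \<in> E. norm (f x) / b > r}"
        using rc b0 A c by (fastforce simp: field_simps)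
      have meas: "{x \<in> E. norm (f x) / b > r} \<in> sets lebesgue"
      proof -
        have "{x \<in> E. norm (f x) / b > r} = {x \<in> space lebesgue. x \<in> E \<and> norm (f x) / b > r}"
          by simp
        also have "\<dots> \<in> sets lebesgue" by measurable
        finally show ?thesis .
      qed
      have "ennreal (\<Theta> r * m) = ennreal (\<Theta> r) * emeasure lebesgue A"
        using A m young_function_nonneg[OF assms(1) r(1)]
        by (simp add: m_def ennreal_mult emeasure_eq_measure2)
      also have "\<dots> \<le> ennreal (\<Theta> r) * emeasure lebesgue {x \<in> E. norm (f x) / b > r}"
        by (intro mult_left_mono emeasure_mono sub meas) simp
      also have "\<dots> \<le> 1"
        using b r0 by (simp add: wL_admissible_def)
      finally have "\<Theta> r * m \<le> 1" by simp
      with r m show False by (simp add: field_simps)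
    qed
    then have "c \<le> g * b" using b0 by (simp add: field_simps)
    then have "ennreal c \<le> ennreal g * ennreal b"
      using g b0 by (simp add: ennreal_mult[symmetric] ennreal_leI)
    then show "ennreal c / ennreal g \<le> ennreal b"
      using g by (intro divide_le_posI_ennreal) auto
  qed
  then have "ennreal c \<le> ennreal g * wL_norm \<Theta> E f"
    using g by (rule le_ennreal_mult_of_divide_le[rotated])
  then show ?thesis by (simp add: g_def m_def)
qed

section \<open>Sizes of balls and the Morrey supremum\<close>

abbreviation ball_size :: "real ^ 'n \<Rightarrow> real \<Rightarrow> real" where
  "ball_size a r \<equiv> measure lebesgue (ball a r) powr (1 / real CARD('n))"

lemma wOM_norm_leI:
  fixes f :: "real ^ 'n \<Rightarrow> 'b::real_normed_vector"
  assumes "\<And>a r. r > 0 \<Longrightarrow>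
    ennreal (1 / \<theta> (ball_size a r) * gen_inverse \<Theta> (1 / measure lebesgue (ball a r)))
      * wL_norm \<Theta> (ball a r) f \<le> K"
  shows "wOM_norm \<theta> \<Theta> f \<le> K"
  unfolding wOM_norm_def using assms by (intro SUP_least) auto

lemma le_wOM_norm:
  fixes f :: "real ^ 'n \<Rightarrow> 'b::real_normed_vector"
  assumes "r > 0"
  shows "ennreal (1 / \<theta> (ball_size a r) * gen_inverse \<Theta> (1 / measure lebesgue (ball a r)))
      * wL_norm \<Theta> (ball a r) f \<le> wOM_norm \<theta> \<Theta> f"
  unfolding wOM_norm_def using assms by (intro SUP_upper2[of "(a, r)"]) auto

lemma measure_lebesgue_ball:
  fixes a :: "real ^ 'n"
  assumes "r \<ge> 0"
  shows "measure lebesgue (ball a r) = unit_ball_vol (real CARD('n)) * r ^ CARD('n)"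
  using content_ball[OF assms, of a] by (simp add: measure_completion)

lemma measure_lebesgue_ball_pos:
  fixes a :: "real ^ 'n"
  assumes "r > 0"
  shows "measure lebesgue (ball a r) > 0"
  using assms by (simp add: measure_lebesgue_ball)

lemma ball_size_pos:
  fixes a :: "real ^ 'n"
  assumes "r > 0"
  shows "ball_size a r > 0"
  using measure_lebesgue_ball_pos[OF assms, of a] by simp

lemma ball_size_power:
  fixes a :: "real ^ 'n"
  assumes "r > 0"
  shows "ball_size a r ^ CARD('n) = measure lebesgue (ball a r)"
  using measure_lebesgue_ball_pos[OF assms, of a]
  by (simp add: powr_realpow[symmetric] powr_powr)

lemma ball_size_mono:
  fixes a :: "real ^ 'n"
  assumes "0 \<le> r" "r \<le> s"
  shows "ball_size a r \<le> ball_size a s"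
  using assms by (intro powr_mono2 measure_mono_fmeasurable subset_ball) auto

lemma ball_size_surj:
  assumes "t > 0"
  obtains r where "r > 0" "ball_size (a :: real ^ 'n) r = t"
proof
  define v where "v = unit_ball_vol (real CARD('n))"
  have v: "v > 0" by (simp add: v_def)
  \<comment> \<open>This radius solves \<open>v * r ^ n = t ^ n\<close>, with \<open>v\<close> the
    volume of the unit ball and \<open>n\<close> the dimension.\<close>
  let ?r = "t / v powr (1 / real CARD('n))"
  show r: "?r > 0" using assms v by simp
  have "measure lebesgue (ball a ?r) = v * ?r ^ CARD('n)"
    using r by (subst measure_lebesgue_ball) (auto simp: v_def)
  also have "\<dots> = t ^ CARD('n)"
    using v by (simp add: power_divide powr_realpow[symmetric] powr_powr)
  finally show "ball_size a ?r = t"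
    using assms by (simp add: powr_realpow[symmetric] powr_powr)
qed

section \<open>A supremum of weighted characteristic functions with finite quasi-norm\<close>

text \<open>
  The supremum has finite quasi-norm because convexity gives \<open>\<Theta> t \<le> c * \<Theta> (t / c)\<close> for \<open>c \<le> 1\<close>:
  a weight \<open>c\<close> on the characteristic function of a ball buys the same factor \<open>c\<close> in the
  measure estimate, and the weights \<open>2 ^ -(k + 1)\<close> sum to 1. The origin is removed since
  \<open>\<theta>\<close> may blow up at 0.
\<close>

lemma weighted_balls_in_wOM_space:
  fixes \<Theta> \<theta> :: "real \<Rightarrow> real" and r :: "nat \<Rightarrow> real"
  assumes young: "young_function \<Theta>" and G: "\<theta> \<in> G_class CARD('n::finite) \<Theta>"
    and r: "\<And>k. r k > 0"
  obtains f :: "real ^ 'n \<Rightarrow> 'b::{real_normed_field, euclidean_space}"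
  where "f \<in> wOM_space \<theta> \<Theta>"
    and "\<And>k x. x \<in> ball 0 (r k) - {0} \<Longrightarrow>
      (1/2) ^ Suc k * \<theta> (ball_size (0 :: real ^ 'n) (r k)) \<le> norm (f x)"
proof -
  define B where "B k = ball (0 :: real ^ 'n) (r k)" for k
  define t where "t k = ball_size (0 :: real ^ 'n) (r k)" for k
  define c where "c k = (1/2) ^ Suc k * \<theta> (t k)" for k
  define g where "g k = (\<lambda>x :: real ^ 'n. c k * indicator (B k - {0}) x)" for k
  define h where "h x = (SUP k. g k x)" for x
  define f where "f x = (of_real (h x) :: 'b)" for x
  have \<theta>pos: "\<theta> s > 0" if "s > 0" for s using G that by (simp add: G_class_def)
  have \<theta>dec: "\<theta> s' \<le> \<theta> s" if "0 < s" "s \<le> s'" for s s'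
    using G that by (auto simp: G_class_def monotone_on_def)
  have tpos: "t k > 0" for k unfolding t_def by (rule ball_size_pos[OF r])
  have cpos: "c k > 0" for k using \<theta>pos[OF tpos] by (simp add: c_def)
  \<comment> \<open>The real supremum needs a bound at each point. A ball \<open>B k\<close>
    containing \<open>x \<noteq> 0\<close> has radius above \<open>norm x\<close>, so monotonicity
    of \<theta> bounds every \<open>g k x\<close> by one value independent of
    \<open>k\<close>.\<close>
  have bdd: "bdd_above (range (\<lambda>k. g k x))" for x
  proof (cases "x = 0")
    case True
    then show ?thesis by (auto simp: g_def)
  next
    case False
    have "g k x \<le> \<theta> (ball_size (0 :: real ^ 'n) (norm x))" for k
    proof (cases "x \<in> B k")
      case True
      then have "g k x = (1/2) ^ Suc k * \<theta> (t k)" using False by (simp add: g_def c_def)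
      also have "\<dots> \<le> 1 * \<theta> (t k)"
        using \<theta>pos[OF tpos[of k]] by (intro mult_right_mono power_le_one) auto
      also have "\<dots> \<le> \<theta> (ball_size (0 :: real ^ 'n) (norm x))"
        using False True unfolding t_def mult_1
        by (intro \<theta>dec ball_size_pos ball_size_mono) (auto simp: B_def)
      finally show ?thesis .
    next
      case nB: False
      then show ?thesis
        using \<theta>pos[OF ball_size_pos[of "norm x" "0 :: real ^ 'n"]] False by (simp add: g_def)
    qed
    then show ?thesis by (intro bdd_aboveI) auto
  qed
  have gh: "g k x \<le> h x" for k x
    unfolding h_def by (rule cSUP_upper[OF _ bdd]) simp
  have g0: "g k x \<ge> 0" for k x
    using cpos[of k] by (simp add: g_def)
  have h0: "h x \<ge> 0" for x using g0[of 0 x] gh[of 0 x] by simp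
  have norm_f: "norm (f x) = h x" for x using h0 by (simp add: f_def)
  have Bm [measurable]: "B k \<in> sets lebesgue" for k by (simp add: B_def)
  have f_meas: "f \<in> borel_measurable lebesgue"
  proof -
    have "h \<in> borel_measurable lebesgue"
      unfolding h_def
    proof (rule borel_measurable_cSUP)
      show "g k \<in> borel_measurable lebesgue" for k
        unfolding g_def by (intro borel_measurable_times borel_measurable_indicator) auto
    qed (use bdd in auto)
    then show ?thesis
      unfolding f_def by (rule measurable_compose[OF _ borel_measurable_of_real])
  qed
  obtain D0 where D0: "\<And>s s'. 0 < s \<Longrightarrow> s \<le> s' \<Longrightarrow>
      gen_inverse \<Theta> (1 / s' ^ CARD('n)) * inverse (\<theta> s')
        \<le> D0 * (gen_inverse \<Theta> (1 / s ^ CARD('n)) * inverse (\<theta> s))"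
    using G by (auto simp: G_class_def almost_decreasing_def)
  \<comment> \<open>The maximum with 1 covers test balls no larger than \<open>B k\<close>, where
    the constant 1 suffices, and makes \<open>D\<close> positive.\<close>
  define D where "D = max D0 1"
  have D1: "D \<ge> 1" by (simp add: D_def)
  \<comment> \<open>In effect, \<open>\<theta> (t k)\<close> times the characteristic function of
    \<open>B k\<close> has quasi-norm at most \<open>D\<close>, uniformly in \<open>k\<close>. For a
    test ball no larger than \<open>B k\<close> this follows from \<theta> being decreasing; for a
    larger one, from the almost decreasing quotient. In each case the intersection is compared with
    the smaller ball.\<close>
  have key: "\<theta> (t k) * gen_inverse \<Theta> (1 / measure lebesgue (ball a R)) / \<theta> (ball_size a R)
      \<le> D * gen_inverse \<Theta> (1 / measure lebesgue (ball a R \<inter> B k))" (is "?lhs \<le> _")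
    if R: "R > 0" and m: "measure lebesgue (ball a R \<inter> B k) > 0" for a :: "real ^ 'n" and R k
  proof -
    let ?m = "measure lebesgue (ball a R \<inter> B k)"
    let ?V = "measure lebesgue (ball a R)"
    let ?T = "ball_size a R"
    have V: "?V > 0" by (rule measure_lebesgue_ball_pos[OF R])
    have T: "?T > 0" by (rule ball_size_pos[OF R])
    have gm: "gen_inverse \<Theta> (1 / ?m) > 0" using m by (intro gen_inverse_pos young) simp
    have gV: "gen_inverse \<Theta> (1 / ?V) > 0" using V by (intro gen_inverse_pos young) simp
    show ?thesis
    proof (cases "?T \<le> t k")
      case True
      have "?m \<le> ?V" by (intro measure_mono_fmeasurable) (auto simp: B_def)
      then have "gen_inverse \<Theta> (1 / ?V) \<le> gen_inverse \<Theta> (1 / ?m)"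
        using m V by (intro gen_inverse_mono young divide_left_mono) auto
      moreover have "\<theta> (t k) / \<theta> ?T \<le> 1"
        using \<theta>dec[OF T True] \<theta>pos[OF T] by simp
      ultimately have "(\<theta> (t k) / \<theta> ?T) * gen_inverse \<Theta> (1 / ?V) \<le> D * gen_inverse \<Theta> (1 / ?m)"
        using D1 gV by (intro mult_mono) auto
      then show ?thesis by simp
    next
      case False
      have W: "measure lebesgue (B k) > 0"
        unfolding B_def by (rule measure_lebesgue_ball_pos[OF r])
      have gW: "gen_inverse \<Theta> (1 / measure lebesgue (B k)) > 0"
        using W by (intro gen_inverse_pos young) simp
      have "?m \<le> measure lebesgue (B k)" by (intro measure_mono_fmeasurable) (auto simp: B_def)
      then have mW: "gen_inverse \<Theta> (1 / measure lebesgue (B k)) \<le> gen_inverse \<Theta> (1 / ?m)"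
        using m W by (intro gen_inverse_mono young divide_left_mono) auto
      \<comment> \<open>Taking powers of the sizes turns the arguments \<open>1 / t ^ n\<close> of
        the class condition into reciprocals of volumes.\<close>
      have "t k ^ CARD('n) = measure lebesgue (B k)" "?T ^ CARD('n) = ?V"
        unfolding t_def B_def by (rule ball_size_power[OF r], rule ball_size_power[OF R])
      with D0[OF tpos[of k], of ?T] False
      have "gen_inverse \<Theta> (1 / ?V) * inverse (\<theta> ?T)
          \<le> D0 * (gen_inverse \<Theta> (1 / measure lebesgue (B k)) * inverse (\<theta> (t k)))" by simp
      also have "\<dots> \<le> D * (gen_inverse \<Theta> (1 / ?m) * inverse (\<theta> (t k)))"
        using gW mW \<theta>pos[OF tpos[of k]] by (intro mult_mono) (auto simp: D_def)
      finally show ?thesis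
        using \<theta>pos[OF tpos[of k]] \<theta>pos[OF T] by (simp add: field_simps)
    qed
  qed
  have "wOM_norm \<theta> \<Theta> f \<le> ennreal D"
  proof (rule wOM_norm_leI)
    fix a :: "real ^ 'n" and R :: real assume R: "R > 0"
    let ?V = "measure lebesgue (ball a R)"
    let ?T = "ball_size a R"
    define G where "G = gen_inverse \<Theta> (1 / ?V)"
    have G0: "G > 0" unfolding G_def
      using measure_lebesgue_ball_pos[OF R, of a] by (intro gen_inverse_pos young) simp
    have T0: "\<theta> ?T > 0" by (rule \<theta>pos[OF ball_size_pos[OF R]])
    \<comment> \<open>Chosen so that the prefactor \<open>G / \<theta> ?T\<close> times
      \<open>b\<close> is exactly \<open>D\<close>.\<close>
    define b where "b = D * \<theta> ?T / G"
    have b0: "b > 0" using D1 G0 T0 by (simp add: b_def)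
    have "wL_admissible \<Theta> (ball a R) f b"
      unfolding wL_admissible_def
    proof (intro conjI allI impI)
      fix s :: real assume s: "s > 0"
      have \<Theta>s: "\<Theta> s \<ge> 0" using young_function_nonneg[OF young] s by simp
      \<comment> \<open>\<open>A k\<close> contains the points of the test ball where
        \<open>g k\<close> exceeds \<open>s * b\<close>; it is empty if the weight
        \<open>c k\<close> is too small to reach that level.\<close>
      define A where "A k = (if s < c k / b then ball a R \<inter> B k else {})" for k
      have Am: "A k \<in> lmeasurable" for k by (auto simp: A_def B_def intro!: fmeasurable.Int)
      have "{x \<in> ball a R. norm (f x) / b > s} \<subseteq> (\<Union>k. A k)"
      proof
        fix x assume x: "x \<in> {x \<in> ball a R. norm (f x) / b > s}"
        then have "s * b < h x" using b0 by (simp add: norm_f field_simps)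
        \<comment> \<open>A number strictly below the supremum lies below some member of the family.
          As \<open>s * b\<close> is positive, the indicator in that member cannot vanish at
          \<open>x\<close>.\<close>
        then obtain k where k: "s * b < g k x"
          unfolding h_def using bdd by (subst (asm) less_cSUP_iff) auto
        moreover have "0 < s * b" using s b0 by simp
        ultimately have "x \<in> B k" "s * b < c k"
          by (cases "x \<in> B k - {0}"; simp add: g_def)+
        then show "x \<in> (\<Union>k. A k)"
          using x b0 by (auto simp: A_def field_simps)
      qed
      then have "ennreal (\<Theta> s) * emeasure lebesgue {x \<in> ball a R. norm (f x) / b > s}
          \<le> ennreal (\<Theta> s) * emeasure lebesgue (\<Union>k. A k)"
        using Am by (intro mult_left_mono emeasure_mono sets.countable_UN) auto
      also have "\<dots> \<le> ennreal (\<Theta> s) * (\<Sum>k. emeasure lebesgue (A k))"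
        using Am by (intro mult_left_mono emeasure_subadditive_countably) auto
      also have "\<dots> = (\<Sum>k. ennreal (\<Theta> s) * emeasure lebesgue (A k))" by simp
      also have "\<dots> \<le> (\<Sum>k. ennreal ((1/2) ^ Suc k))"
      proof (intro suminf_le summableI)
        fix k
        let ?m = "measure lebesgue (A k)"
        have "\<Theta> s * ?m \<le> (1/2) ^ Suc k"
        proof (cases "?m = 0")
          case False
          then have m: "?m > 0" by (simp add: zero_less_measure_iff)
          then have sc: "s < c k / b" and A: "A k = ball a R \<inter> B k"
            by (auto simp: A_def split: if_splits)
          \<comment> \<open>Undoing the weight raises the level to \<open>2 ^ Suc k * s\<close>,
            still below \<open>\<theta> (t k) / b\<close> and hence, by \<open>key\<close>, at most
            the inverse at \<open>1 / ?m\<close>. Convexity then brings the level back to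
            \<open>s\<close> and yields the factor \<open>(1/2) ^ Suc k\<close>.\<close>
          have "2 ^ Suc k * s < \<theta> (t k) / b"
            using sc b0 by (simp add: c_def field_simps)
          also have "\<dots> \<le> gen_inverse \<Theta> (1 / ?m)"
            using key[OF R, of a k] m D1 G0 T0 by (simp add: A b_def G_def field_simps)
          finally have le: "\<Theta> (2 ^ Suc k * s) \<le> 1 / ?m"
            by (rule le_of_less_gen_inverse[rotated, where \<Theta> = \<Theta>]) (use s in simp)
          have "s = (1/2) ^ Suc k * (2 ^ Suc k * s)"
            by (simp only: mult.assoc[symmetric] power_mult_distrib[symmetric]) simp
          then have "\<Theta> s = \<Theta> ((1/2) ^ Suc k * (2 ^ Suc k * s))"
            by (rule arg_cong)
          also have "\<dots> \<le> (1/2) ^ Suc k * \<Theta> (2 ^ Suc k * s)"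
            by (rule young_function_scale_le[OF young])
               (use s in \<open>auto intro!: power_le_one simp del: power_Suc\<close>)
          also have "\<dots> \<le> (1/2) ^ Suc k * (1 / ?m)"
            using le by (rule mult_left_mono) simp
          finally have "\<Theta> s \<le> (1/2) ^ Suc k / ?m"
            by (simp only: times_divide_eq_right mult_1_right)
          then show ?thesis using m by (simp only: pos_le_divide_eq)
        qed simp
        then show "ennreal (\<Theta> s) * emeasure lebesgue (A k) \<le> ennreal ((1/2) ^ Suc k)"
          using \<Theta>s Am[of k]
          by (simp add: emeasure_eq_measure2 ennreal_mult[symmetric] ennreal_leI del: power_Suc)
      qed
      also have "\<dots> = 1"
        using power_half_series by (subst suminf_ennreal_eq) auto
      finally show "ennreal (\<Theta> s) * emeasure lebesgue {x \<in> ball a R. norm (f x) / b > s} \<le> 1" .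
    qed (fact b0)
    then have "ennreal (G / \<theta> ?T) * wL_norm \<Theta> (ball a R) f \<le> ennreal (G / \<theta> ?T) * ennreal b"
      by (intro mult_left_mono wL_norm_le) auto
    also have "\<dots> = ennreal D"
      using G0 T0 b0 by (simp add: ennreal_mult[symmetric] b_def)
    finally show "ennreal (1 / \<theta> ?T * gen_inverse \<Theta> (1 / ?V)) * wL_norm \<Theta> (ball a R) f \<le> ennreal D"
      by (simp add: G_def)
  qed
  then have "f \<in> wOM_space \<theta> \<Theta>"
    using f_meas by (auto simp: wOM_space_def intro: le_less_trans)
  moreover have "(1/2) ^ Suc k * \<theta> (ball_size (0 :: real ^ 'n) (r k)) \<le> norm (f x)"
    if "x \<in> ball 0 (r k) - {0}" for k x
    using gh[of k x] that by (simp add: norm_f g_def c_def t_def B_def)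
  ultimately show thesis by (rule that)
qed

section \<open>Comparison of the quasi-norms and the equivalence\<close>

text \<open>The ball itself serves as test ball: its prefactor cancels both \<theta> and the inverse
  of \<Theta> from the weak Orlicz lower bound, leaving \<open>c\<close>. Removing the centre costs
  no measure.\<close>

lemma le_wOM_norm_of_le_on_punctured_ball:
  fixes f :: "real ^ 'n \<Rightarrow> 'b::euclidean_space"
  assumes "young_function \<Theta>" "f \<in> borel_measurable lebesgue" "R > 0"
    and \<theta>: "\<theta> (ball_size (0 :: real ^ 'n) R) > 0"
    and c: "\<And>x. x \<in> ball 0 R - {0} \<Longrightarrow> c * \<theta> (ball_size (0 :: real ^ 'n) R) \<le> norm (f x)"
  shows "ennreal c \<le> wOM_norm \<theta> \<Theta> f"
proof -
  let ?B = "ball (0 :: real ^ 'n) R"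
  let ?T = "ball_size (0 :: real ^ 'n) R"
  define G where "G = gen_inverse \<Theta> (1 / measure lebesgue ?B)"
  have m: "measure lebesgue (?B - {0}) = measure lebesgue ?B"
    by (intro measure_Diff_null_set) auto
  have V: "measure lebesgue ?B > 0" by (rule measure_lebesgue_ball_pos[OF assms(3)])
  have "ennreal (c * \<theta> ?T) \<le> ennreal G * wL_norm \<Theta> ?B f"
    using le_gen_inverse_mult_wL_norm[OF assms(1,2), of ?B "?B - {0}" "c * \<theta> ?T"] c m V
    by (simp add: G_def fmeasurable_Diff)
  then have "ennreal (1 / \<theta> ?T) * ennreal (c * \<theta> ?T) \<le> ennreal (1 / \<theta> ?T) * (ennreal G * wL_norm \<Theta> ?B f)"
    by (rule mult_left_mono) simp
  moreover have "ennreal (1 / \<theta> ?T) * ennreal (c * \<theta> ?T) = ennreal c"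
    using \<theta> by (simp add: ennreal_mult'[symmetric])
  moreover have "ennreal (1 / \<theta> ?T) * (ennreal G * wL_norm \<Theta> ?B f)
      = ennreal (1 / \<theta> ?T * G) * wL_norm \<Theta> ?B f"
    by (subst ennreal_mult') (use \<theta> in \<open>auto simp: mult.assoc\<close>)
  moreover have "\<dots> \<le> wOM_norm \<theta> \<Theta> f"
    unfolding G_def by (rule le_wOM_norm[OF assms(3)])
  ultimately show ?thesis by simp
qed

text \<open>The weights enter as reciprocals, so bounding \<theta>2 by \<theta>1 bounds the
  prefactor for \<theta>1 by that for \<theta>2.\<close>

lemma wOM_norm_le:
  fixes f :: "real ^ 'n \<Rightarrow> 'b::real_normed_vector"
  assumes \<Theta>2: "young_function \<Theta>2"
    and C: "C1 > 0" "C2 > 0" "C3 > 0"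
    and prec: "\<And>t. t > 0 \<Longrightarrow> \<Theta>1 t \<le> \<Theta>2 (C1 * t)"
    and inv: "\<And>t. t > 0 \<Longrightarrow> gen_inverse \<Theta>1 t \<le> C2 * gen_inverse \<Theta>2 t"
    and \<theta>: "\<And>t. t > 0 \<Longrightarrow> \<theta>2 t \<le> C3 * \<theta>1 t"
    and pos: "\<And>t. t > 0 \<Longrightarrow> \<theta>1 t > 0" "\<And>t. t > 0 \<Longrightarrow> \<theta>2 t > 0"
  shows "wOM_norm \<theta>1 \<Theta>1 f \<le> ennreal (C1 * C2 * C3) * wOM_norm \<theta>2 \<Theta>2 f"
proof (rule wOM_norm_leI)
  fix a :: "real ^ 'n" and r :: real assume r: "r > 0"
  let ?V = "measure lebesgue (ball a r)"
  let ?T = "ball_size a r"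
  let ?c = "1 / \<theta>2 ?T * gen_inverse \<Theta>2 (1 / ?V)"
  have V: "1 / ?V > 0" and T: "?T > 0"
    using r measure_lebesgue_ball_pos[of r a] ball_size_pos[of r a] by auto
  have g2: "gen_inverse \<Theta>2 (1 / ?V) > 0" by (rule gen_inverse_pos[OF \<Theta>2 V])
  have c: "?c \<ge> 0" using g2 pos(2)[OF T] by simp
  have "1 / \<theta>1 ?T \<le> C3 * (1 / \<theta>2 ?T)"
    using \<theta>[OF T] pos[OF T] by (simp add: field_simps)
  then have "1 / \<theta>1 ?T * gen_inverse \<Theta>1 (1 / ?V)
      \<le> (C3 * (1 / \<theta>2 ?T)) * (C2 * gen_inverse \<Theta>2 (1 / ?V))"
    \<comment> \<open>The inverse is replaced before the weight, so that the second replacement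
      multiplies by a bound already known to be nonnegative.\<close>
    using inv[OF V] pos[OF T] C g2
    by (intro order_trans[OF mult_left_mono[OF inv[OF V]] mult_right_mono]) auto
  also have "\<dots> = C2 * C3 * ?c" by simp
  finally have coef: "1 / \<theta>1 ?T * gen_inverse \<Theta>1 (1 / ?V) \<le> C2 * C3 * ?c" .
  have "wL_norm \<Theta>1 (ball a r) f \<le> ennreal C1 * wL_norm \<Theta>2 (ball a r) f"
    by (rule wL_norm_young_prec[OF C(1)]) (rule prec)
  with coef have "ennreal (1 / \<theta>1 ?T * gen_inverse \<Theta>1 (1 / ?V)) * wL_norm \<Theta>1 (ball a r) f
      \<le> ennreal (C2 * C3 * ?c) * (ennreal C1 * wL_norm \<Theta>2 (ball a r) f)"
    by (intro mult_mono[OF ennreal_leI]) simp_all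
  also have "\<dots> = ennreal (C1 * C2 * C3) * (ennreal ?c * wL_norm \<Theta>2 (ball a r) f)"
  proof -
    have "ennreal (C2 * C3 * ?c) = ennreal (C2 * C3) * ennreal ?c"
      using C c by (intro ennreal_mult) auto
    moreover have "ennreal (C1 * C2 * C3) = ennreal C1 * ennreal (C2 * C3)"
      using C by (simp add: ennreal_mult[symmetric] mult.assoc)
    ultimately show ?thesis by (simp only: mult_ac)
  qed
  also have "\<dots> \<le> ennreal (C1 * C2 * C3) * wOM_norm \<theta>2 \<Theta>2 f"
    by (intro mult_left_mono le_wOM_norm r) simp
  finally show "ennreal (1 / \<theta>1 ?T * gen_inverse \<Theta>1 (1 / ?V)) * wL_norm \<Theta>1 (ball a r) f
      \<le> ennreal (C1 * C2 * C3) * wOM_norm \<theta>2 \<Theta>2 f" .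
qed

lemma less_sim_of_wOM_space_subset:
  fixes \<Theta>1 \<Theta>2 \<theta>1 \<theta>2 :: "real \<Rightarrow> real"
  assumes "young_function \<Theta>1" "young_function \<Theta>2"
    and \<theta>1: "\<And>t. t > 0 \<Longrightarrow> \<theta>1 t > 0" and \<theta>2: "\<theta>2 \<in> G_class CARD('n::finite) \<Theta>2"
    and sub: "(wOM_space \<theta>2 \<Theta>2 :: (real ^ 'n \<Rightarrow> 'b::{real_normed_field, euclidean_space}) set)
      \<subseteq> wOM_space \<theta>1 \<Theta>1"
  shows "\<theta>2 \<lesssim> \<theta>1"
proof (rule ccontr)
  assume "\<not> \<theta>2 \<lesssim> \<theta>1"
  then have no: "\<exists>t>0. C * \<theta>1 t < \<theta>2 t" if "C > 0" for C
    using that by (force simp: less_sim_def not_le)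
  \<comment> \<open>The factor \<open>2 ^ Suc k\<close> offsets the weight of the k-th ball; the
    factor \<open>Suc k\<close> survives and drives the quasi-norm for \<theta>1 to
    infinity.\<close>
  have "\<exists>r>0. real (Suc k) * 2 ^ Suc k * \<theta>1 (ball_size (0 :: real ^ 'n) r)
      < \<theta>2 (ball_size (0 :: real ^ 'n) r)" for k
  proof -
    obtain t where t: "t > 0" "real (Suc k) * 2 ^ Suc k * \<theta>1 t < \<theta>2 t"
      using no[of "real (Suc k) * 2 ^ Suc k"] by auto
    moreover obtain r where "r > 0" "ball_size (0 :: real ^ 'n) r = t"
      by (rule ball_size_surj[OF t(1)])
    ultimately show ?thesis by metis
  qed
  then obtain r where r: "\<And>k. r k > 0"
    and large: "\<And>k. real (Suc k) * 2 ^ Suc k * \<theta>1 (ball_size (0 :: real ^ 'n) (r k))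
      < \<theta>2 (ball_size (0 :: real ^ 'n) (r k))" by metis
  obtain f :: "real ^ 'n \<Rightarrow> 'b" where f: "f \<in> wOM_space \<theta>2 \<Theta>2"
    and lower: "\<And>k x. x \<in> ball 0 (r k) - {0} \<Longrightarrow>
      (1/2) ^ Suc k * \<theta>2 (ball_size (0 :: real ^ 'n) (r k)) \<le> norm (f x)"
    using weighted_balls_in_wOM_space[where r = r, OF assms(2) \<theta>2 r] by blast
  have f1: "f \<in> borel_measurable lebesgue" "wOM_norm \<theta>1 \<Theta>1 f < \<infinity>"
    using f sub by (auto simp: wOM_space_def)
  have "of_nat k \<le> wOM_norm \<theta>1 \<Theta>1 f" for k
  proof -
    have "ennreal (real (Suc k)) \<le> wOM_norm \<theta>1 \<Theta>1 f"
    proof (rule le_wOM_norm_of_le_on_punctured_ball[OF assms(1) f1(1) r[of k]])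
      show "\<theta>1 (ball_size (0 :: real ^ 'n) (r k)) > 0" by (rule \<theta>1[OF ball_size_pos[OF r]])
      fix x :: "real ^ 'n" assume x: "x \<in> ball 0 (r k) - {0}"
      have "real (Suc k) * \<theta>1 (ball_size (0 :: real ^ 'n) (r k))
          \<le> (1/2) ^ Suc k * \<theta>2 (ball_size (0 :: real ^ 'n) (r k))"
        using large[of k] by (simp add: power_one_over field_simps)
      with lower[OF x] show "real (Suc k) * \<theta>1 (ball_size (0 :: real ^ 'n) (r k)) \<le> norm (f x)"
        by linarith
    qed
    moreover have "of_nat k \<le> ennreal (real (Suc k))"
      by (simp add: ennreal_of_nat_eq_real_of_nat ennreal_leI)
    ultimately show ?thesis by order
  qed
  then have "wOM_norm \<theta>1 \<Theta>1 f = top"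
    by (metis SUP_least ennreal_SUP_of_nat_eq_top top.extremum_uniqueI)
  with f1(2) show False by simp
qed

theorem mainTheorem1:
  fixes \<Theta>1 \<Theta>2 \<theta>1 \<theta>2 :: "real \<Rightarrow> real"
  assumes "young_function \<Theta>1" and "young_function \<Theta>2"
    and "\<Theta>1 \<prec>\<^sub>Y \<Theta>2"
    and "gen_inverse \<Theta>1 \<lesssim> gen_inverse \<Theta>2"
    and "\<theta>1 \<in> G_class CARD('n::finite) \<Theta>1"
    and "\<theta>2 \<in> G_class CARD('n) \<Theta>2"
  shows "(\<theta>2 \<lesssim> \<theta>1 \<longleftrightarrow>
            (wOM_space \<theta>2 \<Theta>2 :: (real ^ 'n \<Rightarrow> 'b::{real_normed_field, euclidean_space}) set)
              \<subseteq> wOM_space \<theta>1 \<Theta>1)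
       \<and> ((wOM_space \<theta>2 \<Theta>2 :: (real ^ 'n \<Rightarrow> 'b) set) \<subseteq> wOM_space \<theta>1 \<Theta>1 \<longleftrightarrow>
            (\<exists>C>0. \<forall>f \<in> (wOM_space \<theta>2 \<Theta>2 :: (real ^ 'n \<Rightarrow> 'b) set).
               wOM_norm \<theta>1 \<Theta>1 f \<le> ennreal C * wOM_norm \<theta>2 \<Theta>2 f))"
    (is "(?one \<longleftrightarrow> ?two) \<and> (?two \<longleftrightarrow> ?three)")
proof -
  have pos: "\<And>t. t > 0 \<Longrightarrow> \<theta>1 t > 0" "\<And>t. t > 0 \<Longrightarrow> \<theta>2 t > 0"
    using assms(5,6) by (auto simp: G_class_def)
  \<comment> \<open>The equivalences are closed by the cycle (1) to (3) to (2) to (1). The middle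
    step holds because a finite constant times a finite quasi-norm is finite.\<close>
  have "?three" if one: ?one
  proof -
    obtain C1 C2 C3 where C: "C1 > 0" "C2 > 0" "C3 > 0"
      and "\<And>t. t > 0 \<Longrightarrow> \<Theta>1 t \<le> \<Theta>2 (C1 * t)"
      and "\<And>t. t > 0 \<Longrightarrow> gen_inverse \<Theta>1 t \<le> C2 * gen_inverse \<Theta>2 t"
      and "\<And>t. t > 0 \<Longrightarrow> \<theta>2 t \<le> C3 * \<theta>1 t"
      using assms(3,4) one unfolding young_prec_def less_sim_def by metis
    from wOM_norm_le[OF assms(2) this pos] C show ?thesis
      by (intro exI[of _ "C1 * C2 * C3"]) auto
  qed
  moreover have "?two" if ?three
    using that by (auto simp: wOM_space_def ennreal_mult_less_top intro: le_less_trans)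
  moreover have "?one" if ?two
    by (rule less_sim_of_wOM_space_subset[OF assms(1,2) pos(1) assms(6) that])
  ultimately show ?thesis by blast
qed

end
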